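(* Let $\mathcal{K}$ be a coronoid. Then the complement $\mathcal{K}^\complement=\mathcal{H}\setminus\mathcal{K}$ has a finite number $d+1$, $d\ge 0$, of connected components $\mathcal{B}_\infty,\mathcal{B}_1,\dots,\mathcal{B}_d$, so that $\mathcal{K}^\complement=\mathcal{B}_\infty\sqcup\mathcal{B}_1\sqcup\cdots\sqcup\mathcal{B}_d$. Exactly one component, $\mathcal{B}_\infty$, is infinite, and each of the other $d$ components is finite and is a benzenoid. Moreover, $\mathcal{H}\setminus\mathcal{B}_\infty$ is also a benzenoid.
   Context: $\mathcal{H}$ is the set of hexagons of the regular hexagonal tiling of the Euclidean plane. Two hexagons are adjacent if they are distinct and share an edge. A hexagonal system is any subset $\mathcal{K}\subseteq\mathcal{H}$. For $a,b\in\mathcal{K}$, $a\equiv_{\mathcal{K}}b$ if there is a sequence $a=c_0,\dots,c_m=b$ of hexagons of $\mathcal{K}$ with $c_{i-1}$ adjacent to $c_i$; the equivalence classes are the connected components of $\mathcal{K}$, and $\mathcal{K}$ is connected if it has exactly one component. A (general) coronoid is a finite connected hexagonal system; a benzenoid is a coronoid whose complement in $\mathcal{H}$ is connected. *)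

theory Defs
  imports "HOL-Analysis.Analysis"
begin

text \<open>The Euclidean plane is \<^typ>\<open>complex\<close>; the regular hexagonal tiling, unique up to
  similarity, is normalised to have side length 1.\<close>

definition hexagon :: "complex \<Rightarrow> complex set" where
  "hexagon c = convex hull {c + cis (real k * pi / 3) | k::nat. k < 6}"

text \<open>The centres of the tiles form the lattice spanned by two of the vectors joining the centres
  of neighbouring hexagons, of length \<open>sqrt 3\<close> and arguments \<open>pi / 6\<close> and \<open>pi / 2\<close>.\<close>

definition hexagons :: "complex set set" where
  "hexagons = {hexagon (of_int m * (sqrt 3 * cis (pi / 6)) + of_int n * (sqrt 3 * cis (pi / 2)))
               | m n :: int. True}"

definition hex_adjacent :: "complex set \<Rightarrow> complex set \<Rightarrow> bool" where
  "hex_adjacent a b \<longleftrightarrow> a \<noteq> b \<and> (\<exists>e. e edge_of a \<and> e edge_of b)"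

definition hex_equiv :: "complex set set \<Rightarrow> (complex set \<times> complex set) set" where
  "hex_equiv K = {(a, b). \<exists>(m::nat) c. c 0 = a \<and> c m = b \<and> (\<forall>i\<le>m. c i \<in> K) \<and>
                     (\<forall>i\<in>{1..m}. hex_adjacent (c (i - 1)) (c i))}"

definition hex_components :: "complex set set \<Rightarrow> complex set set set" where
  "hex_components K = K // hex_equiv K"

text \<open>In particular the empty system, having no component, is not connected.\<close>

definition hex_connected :: "complex set set \<Rightarrow> bool" where
  "hex_connected K \<longleftrightarrow> (\<exists>!C. C \<in> hex_components K)"

definition coronoid :: "complex set set \<Rightarrow> bool" where
  "coronoid K \<longleftrightarrow> K \<subseteq> hexagons \<and> finite K \<and> hex_connected K"

definition benzenoid :: "complex set set \<Rightarrow> bool" where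
  "benzenoid K \<longleftrightarrow> coronoid K \<and> hex_connected (hexagons - K)"

end

theory Submission
  imports Defs
begin

text \<open>Adding a unit step along either lattice generator leads to an adjacent tile, so the adjacency
  graph of the tiling contains the square grid; hence it is connected, and so is the outside of any
  box of the grid. Choosing a box that contains the finite system \<open>K\<close>, one component of the complement
  contains the outside of the box and every other one lies inside, so there are finitely many and
  they are finite. A path of the tiling from a point outside a component \<open>C\<close> to \<open>K\<close> cannot enter \<open>C\<close>
  before it meets \<open>K\<close>; as \<open>K\<close> is connected, the complement of \<open>C\<close> is therefore connected.\<close>

section \<open>Components of hexagonal systems\<close>

text \<open>Adjacency restricted to \<open>K\<close>, so that walks inside \<open>K\<close> become
  its reflexive transitive closure and rtrancl induction replaces indexed sequences.\<close>

definition adj_rel :: "complex set set \<Rightarrow> (complex set \<times> complex set) set" where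
  "adj_rel K = {(x, y). x \<in> K \<and> y \<in> K \<and> hex_adjacent x y}"

lemma hex_adjacent_sym: "hex_adjacent a b \<Longrightarrow> hex_adjacent b a"
  by (auto simp: hex_adjacent_def)

text \<open>A sequence with \<open>m\<close> steps is a member of the \<open>m\<close>-th relation
  power. The conjunct \<open>a \<in> K\<close> excludes the pairs \<open>(a, a)\<close> with
  \<open>a\<close> outside \<open>K\<close>, which every reflexive closure contains.\<close>

lemma hex_equiv_iff: "(a, b) \<in> hex_equiv K \<longleftrightarrow> a \<in> K \<and> (a, b) \<in> (adj_rel K)\<^sup>*"
proof
  assume "(a, b) \<in> hex_equiv K"
  then obtain m c where c: "c 0 = a" "c (m::nat) = b" "\<forall>i\<le>m. c i \<in> K"
      "\<forall>i\<in>{1..m}. hex_adjacent (c (i - 1)) (c i)"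
    by (auto simp: hex_equiv_def)
  have "(c i, c (Suc i)) \<in> adj_rel K" if "i < m" for i
    using that c(3) c(4)[rule_format, of "Suc i"] by (auto simp: adj_rel_def)
  then have "(a, b) \<in> (adj_rel K) ^^ m"
    using c(1,2) by (auto simp: relpow_fun_conv)
  then show "a \<in> K \<and> (a, b) \<in> (adj_rel K)\<^sup>*"
    using c(1,3) by (auto intro: relpow_imp_rtrancl)
next
  assume R: "a \<in> K \<and> (a, b) \<in> (adj_rel K)\<^sup>*"
  then obtain m where "(a, b) \<in> (adj_rel K) ^^ m"
    by (auto dest: rtrancl_imp_relpow)
  then obtain c where c: "c 0 = a" "c m = b" "\<forall>i<m. (c i, c (Suc i)) \<in> adj_rel K"
    by (auto simp: relpow_fun_conv)
  have "c i \<in> K" if "i \<le> m" for i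
    using that R c by (cases i) (auto simp: adj_rel_def)
  moreover have "hex_adjacent (c (i - 1)) (c i)" if "i \<in> {1..m}" for i
    using that c(3)[rule_format, of "i - 1"] by (auto simp: adj_rel_def)
  ultimately show "(a, b) \<in> hex_equiv K"
    using c(1,2) unfolding hex_equiv_def by blast
qed

lemma equiv_hex_equiv: "equiv K (hex_equiv K)"
proof (rule equivI)
  show "hex_equiv K \<subseteq> K \<times> K"
  proof clarify
    fix a b assume "(a, b) \<in> hex_equiv K"
    then have "a \<in> K" "(a, b) \<in> (adj_rel K)\<^sup>*"
      by (simp_all add: hex_equiv_iff)
    from this(2,1) show "a \<in> K \<and> b \<in> K"
      by (induction rule: rtrancl_induct) (auto simp: adj_rel_def)
  qed
  then have fld: "b \<in> K" if "(a, b) \<in> hex_equiv K" for a b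
    using that by blast
  show "refl_on K (hex_equiv K)"
    by (rule refl_onI) (simp add: hex_equiv_iff)
  have "sym ((adj_rel K)\<^sup>*)"
    by (intro sym_rtrancl symI) (auto simp: adj_rel_def hex_adjacent_sym)
  then show "sym (hex_equiv K)"
    using fld by (intro symI) (metis hex_equiv_iff symD)
  show "trans (hex_equiv K)"
    by (intro transI) (auto simp: hex_equiv_iff)
qed

lemma hex_equiv_sym: "(a, b) \<in> hex_equiv K \<Longrightarrow> (b, a) \<in> hex_equiv K"
  using equiv_hex_equiv by (meson equivE symD)

lemma hex_equiv_trans:
  "(a, b) \<in> hex_equiv K \<Longrightarrow> (b, c) \<in> hex_equiv K \<Longrightarrow> (a, c) \<in> hex_equiv K"
  using equiv_hex_equiv by (meson equivE transD)

lemma hex_equiv_mono: "K \<subseteq> L \<Longrightarrow> (a, b) \<in> hex_equiv K \<Longrightarrow> (a, b) \<in> hex_equiv L"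
  using rtrancl_mono[of "adj_rel K" "adj_rel L"] by (auto simp: hex_equiv_iff adj_rel_def)

lemma hex_equiv_adjacent:
  "a \<in> K \<Longrightarrow> b \<in> K \<Longrightarrow> hex_adjacent a b \<Longrightarrow> (a, b) \<in> hex_equiv K"
  by (auto simp: hex_equiv_iff adj_rel_def)

text \<open>The components are the classes of an equivalence on \<open>K\<close>, so a unique class
  means that \<open>K\<close> has a point and all its points are related.\<close>

lemma hex_connected_iff:
  "hex_connected K \<longleftrightarrow> K \<noteq> {} \<and> (\<forall>a\<in>K. \<forall>b\<in>K. (a, b) \<in> hex_equiv K)"
proof
  assume "hex_connected K"
  then obtain C where C: "K // hex_equiv K = {C}"
    by (auto simp: hex_connected_def hex_components_def)
  then have "hex_equiv K `` {a} = hex_equiv K `` {b}" if "a \<in> K" "b \<in> K" for a b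
    using that by (metis quotientI singletonD)
  then show "K \<noteq> {} \<and> (\<forall>a\<in>K. \<forall>b\<in>K. (a, b) \<in> hex_equiv K)"
    using C eq_equiv_class_iff[OF equiv_hex_equiv] by fastforce
next
  assume R: "K \<noteq> {} \<and> (\<forall>a\<in>K. \<forall>b\<in>K. (a, b) \<in> hex_equiv K)"
  then obtain k where k: "k \<in> K" by blast
  have "C = hex_equiv K `` {k}" if "C \<in> hex_components K" for C
    using that R k equiv_class_eq[OF equiv_hex_equiv]
    unfolding hex_components_def by (metis quotientE)
  then show "hex_connected K"
    using k unfolding hex_connected_def hex_components_def by (metis quotientI)
qed

lemma Union_hex_components: "\<Union> (hex_components K) = K"
  unfolding hex_components_def by (rule Union_quotient[OF equiv_hex_equiv])

text \<open>Every tile on a walk in \<open>K\<close> from \<open>x\<close> is itself equivalent to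
  \<open>x\<close>, so the walk never leaves the class of \<open>x\<close> and also witnesses
  equivalence within that class.\<close>

lemma hex_connected_component:
  assumes "C \<in> hex_components K"
  shows "hex_connected C"
proof -
  obtain x where x: "x \<in> K" "C = hex_equiv K `` {x}"
    using assms unfolding hex_components_def by (rule quotientE)
  have to_x: "(x, y) \<in> hex_equiv C" if "(x, y) \<in> (adj_rel K)\<^sup>*" for y
    using that
  proof (induction rule: rtrancl_induct)
    case base
    then show ?case using x by (simp add: hex_equiv_iff)
  next
    case (step y z)
    have "y \<in> C" "z \<in> C"
      using step.hyps x rtrancl_into_rtrancl[OF step.hyps] by (auto simp: hex_equiv_iff)
    then have "(y, z) \<in> hex_equiv C"
      using step.hyps by (auto simp: adj_rel_def intro: hex_equiv_adjacent)
    then show ?case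
      using step.IH by (blast intro: hex_equiv_sym hex_equiv_trans)
  qed
  have "(a, b) \<in> hex_equiv C" if "a \<in> C" "b \<in> C" for a b
  proof (rule hex_equiv_trans)
    show "(a, x) \<in> hex_equiv C" "(x, b) \<in> hex_equiv C"
      using that x to_x by (auto simp: hex_equiv_iff[of x _ K] intro: hex_equiv_sym)
  qed
  moreover have "C \<noteq> {}"
    using x by (auto simp: hex_equiv_iff)
  ultimately show ?thesis
    by (simp add: hex_connected_iff)
qed

lemma hex_connected_Diff_component:
  assumes L: "hex_connected L" and K: "hex_connected K" "K \<subseteq> L"
    and C: "C \<in> hex_components (L - K)"
  shows "hex_connected (L - C)"
proof -
  obtain k where k: "k \<in> K"
    using K by (auto simp: hex_connected_iff)
  have CL: "C \<subseteq> L - K"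
    using C Union_hex_components by (metis Union_upper)
  have KC: "K \<subseteq> L - C"
    using CL K by blast
  \<comment> \<open>Induction from the end \<open>k\<close> of the walk backwards. The implication
    allows for walks that pass through \<open>C\<close>: once a tile of \<open>K\<close> is met, the
    rest of the walk is discarded and replaced by one inside \<open>K\<close>, which avoids
    \<open>C\<close>.\<close>
  have *: "x \<in> L - C \<longrightarrow> (x, k) \<in> hex_equiv (L - C)" if "(x, k) \<in> (adj_rel L)\<^sup>*" for x
    using that
  proof (induction rule: converse_rtrancl_induct)
    case base
    then show ?case by (simp add: hex_equiv_iff)
  next
    case (step x y)
    show ?case
    proof
      assume x: "x \<in> L - C"
      show "(x, k) \<in> hex_equiv (L - C)"
      proof (cases "x \<in> K")
        case True
        then show ?thesis
          using K k hex_equiv_mono[OF KC] by (auto simp: hex_connected_iff)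
      next
        case False
        have xy: "hex_adjacent x y" "y \<in> L"
          using step by (auto simp: adj_rel_def)
        \<comment> \<open>A component of \<open>L - K\<close> contains every tile of
          \<open>L - K\<close> adjacent to one of its own, so \<open>C\<close> can only be entered
          from \<open>K\<close>.\<close>
        have "y \<notin> C"
        proof
          assume y: "y \<in> C"
          then have "(y, x) \<in> hex_equiv (L - K)"
            using CL x False xy hex_adjacent_sym by (intro hex_equiv_adjacent) auto
          then have "x \<in> C"
            using y C in_quotient_imp_closed[OF equiv_hex_equiv] unfolding hex_components_def by metis
          then show False using x by simp
        qed
        then have "(x, y) \<in> hex_equiv (L - C)" "(y, k) \<in> hex_equiv (L - C)"
          using x xy step.IH by (auto intro: hex_equiv_adjacent)
        then show ?thesis
          by (blast intro: hex_equiv_sym hex_equiv_trans)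
      qed
    qed
  qed
  have "(x, k) \<in> hex_equiv (L - C)" if "x \<in> L - C" for x
    using * that L k K by (auto simp: hex_connected_iff hex_equiv_iff)
  then have "(x, y) \<in> hex_equiv (L - C)" if "x \<in> L - C" "y \<in> L - C" for x y
    using that by (blast intro: hex_equiv_sym hex_equiv_trans)
  then show ?thesis
    using k KC by (auto simp: hex_connected_iff)
qed

section \<open>The grid of hexagons\<close>

text \<open>The line \<open>a \<bullet> x = b\<close> supports the hull and meets \<open>V\<close>
  only in \<open>p\<close> and \<open>q\<close>. Hence the affine hull of these two misses the hull
  of the other points, which makes the segment a face; its dimension is 1 because
  \<open>p \<noteq> q\<close>.\<close>

lemma edge_of_convex_hull:
  fixes p q a :: "'a::euclidean_space"
  assumes "finite V" "p \<in> V" "q \<in> V" "p \<noteq> q" "a \<bullet> p = b" "a \<bullet> q = b"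
    and less: "\<forall>v \<in> V - {p, q}. a \<bullet> v < b"
  shows "convex hull {p, q} edge_of convex hull V"
proof -
  have "affine hull {p, q} \<subseteq> {x. a \<bullet> x = b}"
    using assms by (intro hull_minimal) (auto simp: affine_hyperplane)
  moreover have "convex hull (V - {p, q}) \<subseteq> {x. a \<bullet> x < b}"
    using less by (intro hull_minimal) (auto simp: convex_halfspace_lt)
  ultimately have "affine hull {p, q} \<inter> convex hull (V - {p, q}) = {}"
    by fastforce
  then have "convex hull {p, q} face_of convex hull V"
    using assms by (intro face_of_convex_hulls) auto
  then show ?thesis
    using assms by (simp add: edge_of_def aff_dim_convex_hull aff_dim_2)
qed

lemma cis_multiples_pi3:
  "cis (pi / 3) = Complex (1/2) (sqrt 3 / 2)"
  "cis (2 * pi / 3) = Complex (- 1/2) (sqrt 3 / 2)"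
  "cis (4 * pi / 3) = Complex (- 1/2) (- sqrt 3 / 2)"
  "cis (5 * pi / 3) = Complex (1/2) (- sqrt 3 / 2)"
proof -
  show 1: "cis (pi / 3) = Complex (1/2) (sqrt 3 / 2)"
    by (simp add: complex_eq_iff cos_60 sin_60)
  show 2: "cis (2 * pi / 3) = Complex (- 1/2) (sqrt 3 / 2)"
    by (simp add: complex_eq_iff cos_120 sin_120)
  have "cis (4 * pi / 3) = cis pi * cis (pi / 3)" "cis (5 * pi / 3) = cis pi * cis (2 * pi / 3)"
    unfolding cis_mult by (rule arg_cong[where f = cis], simp add: field_simps)+
  then show "cis (4 * pi / 3) = Complex (- 1/2) (- sqrt 3 / 2)"
      "cis (5 * pi / 3) = Complex (1/2) (- sqrt 3 / 2)"
    unfolding 1 2 by (simp_all add: complex_eq_iff)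
qed

lemma hexagon_eq:
  "hexagon c = convex hull ((+) c ` {1, Complex (1/2) (sqrt 3 / 2), Complex (- 1/2) (sqrt 3 / 2),
     - 1, Complex (- 1/2) (- sqrt 3 / 2), Complex (1/2) (- sqrt 3 / 2)})"
proof -
  have "{c + cis (real k * pi / 3) | k::nat. k < 6} = (+) c ` (\<lambda>k. cis (real k * pi / 3)) ` {..<6}"
    by auto
  also have "{..<6::nat} = {0, 1, 2, 3, 4, 5}"
    by auto
  finally show ?thesis
    unfolding hexagon_def image_insert image_empty
    using cis_multiples_pi3 by simp
qed

lemma hexagon_edge:
  assumes "p \<in> V" "q \<in> V" "p \<noteq> q" "a \<bullet> p = b" "a \<bullet> q = b" "\<forall>v \<in> V - {p, q}. a \<bullet> v < b"
    and V: "V = {1, Complex (1/2) (sqrt 3 / 2), Complex (- 1/2) (sqrt 3 / 2),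
     - 1, Complex (- 1/2) (- sqrt 3 / 2), Complex (1/2) (- sqrt 3 / 2)}"
  shows "convex hull {c + p, c + q} edge_of hexagon c"
  unfolding hexagon_eq V[symmetric]
\<comment> \<open>Translating the vertices by \<open>c\<close> raises the level of the supporting
  line by \<open>a \<bullet> c\<close>.\<close>
proof (rule edge_of_convex_hull[where a = a and b = "a \<bullet> c + b"])
  show "finite ((+) c ` V)"
    by (simp add: V)
qed (use assms(1-6) in \<open>auto simp: inner_add_right\<close>)

lemma hexagon_subset_cball: "hexagon c \<subseteq> cball c 1"
  unfolding hexagon_def by (intro hull_minimal) (auto simp: dist_norm)

text \<open>The opposite vertices \<open>c + 1\<close> and \<open>c - 1\<close> both lie in the unit
  disc about \<open>c'\<close>. With \<open>d = c - c'\<close>, the squared norms of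
  \<open>d + 1\<close> and \<open>d - 1\<close> add up to twice that of \<open>d\<close> plus 2, yet
  to at most 2; so \<open>d = 0\<close>.\<close>

lemma inj_hexagon: "inj hexagon"
proof
  fix c c' assume eq: "hexagon c = hexagon c'"
  have "c + 1 \<in> hexagon c" "c - 1 \<in> hexagon c"
    unfolding hexagon_eq by (simp_all add: hull_inc)
  then have "c + 1 \<in> cball c' 1" "c - 1 \<in> cball c' 1"
    using eq hexagon_subset_cball by blast+
  then have "norm ((c - c') + 1) \<le> 1" "norm ((c - c') - 1) \<le> 1"
    by (auto simp: dist_norm norm_minus_commute algebra_simps)
  then have "(norm ((c - c') + 1))\<^sup>2 \<le> 1" "(norm ((c - c') - 1))\<^sup>2 \<le> 1"
    by (simp_all add: power_le_one)
  then have "(norm (c - c'))\<^sup>2 \<le> 0"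
    unfolding cmod_power2 by (simp add: power2_eq_square algebra_simps)
  then show "c = c'"
    by simp
qed

section \<open>Lattice coordinates and neighbouring tiles\<close>

definition grid_hexagon :: "int \<Rightarrow> int \<Rightarrow> complex set" where
  "grid_hexagon m n = hexagon (of_int m * (sqrt 3 * cis (pi / 6)) + of_int n * (sqrt 3 * cis (pi / 2)))"

lemma grid_centre:
  "of_int m * (sqrt 3 * cis (pi / 6)) + of_int n * (sqrt 3 * cis (pi / 2))
   = Complex (3 / 2 * m) (sqrt 3 / 2 * m + sqrt 3 * n)"
  by (simp add: complex_eq_iff cos_30 sin_30)

lemma hexagons_eq: "hexagons = range (\<lambda>(m, n). grid_hexagon m n)"
  unfolding hexagons_def grid_hexagon_def by auto

lemma grid_hexagon_eq_iff [simp]: "grid_hexagon m n = grid_hexagon m' n' \<longleftrightarrow> m = m' \<and> n = n'"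
  unfolding grid_hexagon_def grid_centre inj_eq[OF inj_hexagon] by auto

text \<open>The common edge lies on the perpendicular bisector of the two centres. The vector
  between them is therefore the outer normal for one tile and its negative for the other, and the
  level \<open>3/2\<close> is half its squared length 3.\<close>

lemma hexagon_adjacent_right: "hex_adjacent (hexagon c) (hexagon (c + Complex (3/2) (sqrt 3 / 2)))"
proof -
  let ?d = "c + Complex (3/2) (sqrt 3 / 2)"
  let ?u = "Complex (1/2) (sqrt 3 / 2)"
  have "convex hull {c + 1, c + ?u} edge_of hexagon c"
    by (rule hexagon_edge[where a = "Complex (3/2) (sqrt 3 / 2)" and b = "3/2", OF _ _ _ _ _ _ refl])
       (auto simp: inner_complex_def complex_eq_iff)
  moreover have "convex hull {?d + Complex (- 1/2) (- sqrt 3 / 2), ?d + (- 1)} edge_of hexagon ?d"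
    by (rule hexagon_edge[where a = "- Complex (3/2) (sqrt 3 / 2)" and b = "3/2", OF _ _ _ _ _ _ refl])
       (auto simp: inner_complex_def complex_eq_iff)
  moreover have "?d + Complex (- 1/2) (- sqrt 3 / 2) = c + 1" "?d + (- 1) = c + ?u"
    by (simp_all add: complex_eq_iff)
  moreover have "hexagon c \<noteq> hexagon ?d"
    unfolding inj_eq[OF inj_hexagon] by (simp add: complex_eq_iff)
  ultimately show ?thesis
    unfolding hex_adjacent_def by metis
qed

lemma hexagon_adjacent_up: "hex_adjacent (hexagon c) (hexagon (c + Complex 0 (sqrt 3)))"
proof -
  let ?d = "c + Complex 0 (sqrt 3)"
  let ?u = "Complex (1/2) (sqrt 3 / 2)" and ?v = "Complex (- 1/2) (sqrt 3 / 2)"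
  have "convex hull {c + ?u, c + ?v} edge_of hexagon c"
    by (rule hexagon_edge[where a = "Complex 0 (sqrt 3)" and b = "3/2", OF _ _ _ _ _ _ refl])
       (auto simp: inner_complex_def complex_eq_iff)
  moreover have "convex hull {?d + Complex (1/2) (- sqrt 3 / 2), ?d + Complex (- 1/2) (- sqrt 3 / 2)}
      edge_of hexagon ?d"
    by (rule hexagon_edge[where a = "- Complex 0 (sqrt 3)" and b = "3/2", OF _ _ _ _ _ _ refl])
       (auto simp: inner_complex_def complex_eq_iff)
  moreover have "?d + Complex (1/2) (- sqrt 3 / 2) = c + ?u" "?d + Complex (- 1/2) (- sqrt 3 / 2) = c + ?v"
    by (simp_all add: complex_eq_iff)
  moreover have "hexagon c \<noteq> hexagon ?d"
    unfolding inj_eq[OF inj_hexagon] by (simp add: complex_eq_iff)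
  ultimately show ?thesis
    unfolding hex_adjacent_def by metis
qed

lemma grid_adjacent:
  "hex_adjacent (grid_hexagon m n) (grid_hexagon (m + 1) n)"
  "hex_adjacent (grid_hexagon m n) (grid_hexagon m (n + 1))"
proof -
  let ?c = "Complex (3 / 2 * m) (sqrt 3 / 2 * m + sqrt 3 * n)"
  have "Complex (3 / 2 * (m + 1)) (sqrt 3 / 2 * (m + 1) + sqrt 3 * n)
      = ?c + Complex (3/2) (sqrt 3 / 2)"
    by (simp add: complex_eq_iff algebra_simps add_divide_distrib)
  then show "hex_adjacent (grid_hexagon m n) (grid_hexagon (m + 1) n)"
    using hexagon_adjacent_right[of ?c] unfolding grid_hexagon_def grid_centre by simp
  have "Complex (3 / 2 * m) (sqrt 3 / 2 * m + sqrt 3 * (n + 1)) = ?c + Complex 0 (sqrt 3)"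
    by (simp add: complex_eq_iff algebra_simps)
  then show "hex_adjacent (grid_hexagon m n) (grid_hexagon m (n + 1))"
    using hexagon_adjacent_up[of ?c] unfolding grid_hexagon_def grid_centre by simp
qed

section \<open>Walks along grid lines and around a box\<close>

lemma hex_equiv_int_path:
  assumes "\<And>i::int. f i \<in> K" "\<And>i. hex_adjacent (f i) (f (i + 1))"
  shows "(f i, f j) \<in> hex_equiv K"
proof -
  have "(f i, f j) \<in> hex_equiv K" if "i \<le> j" for i j
    using that
  proof (induction j rule: int_ge_induct)
    case base
    then show ?case using assms by (simp add: hex_equiv_iff)
  next
    case (step j)
    then show ?case
      using hex_equiv_adjacent[OF assms(1,1,2)] by (blast intro: hex_equiv_sym hex_equiv_trans)
  qed
  then show ?thesis
    by (cases "i \<le> j") (auto intro: hex_equiv_sym)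
qed

text \<open>A grid line whose fixed coordinate has absolute value at least \<open>N\<close> stays in
  \<open>K\<close>. Following such a line through the given tile and then turning at the line with
  fixed coordinate \<open>N\<close> reaches the corner \<open>(N, N)\<close>.\<close>

lemma hex_equiv_outside_box:
  assumes far: "\<And>m n. N \<le> \<bar>m\<bar> \<or> N \<le> \<bar>n\<bar> \<Longrightarrow> grid_hexagon m n \<in> K"
    and mn: "N \<le> \<bar>m\<bar> \<or> N \<le> \<bar>n\<bar>"
  shows "(grid_hexagon m n, grid_hexagon N N) \<in> hex_equiv K"
proof -
  have row: "(grid_hexagon i j, grid_hexagon i' j) \<in> hex_equiv K" if "N \<le> \<bar>j\<bar>" for i i' j
    using that hex_equiv_int_path[of "\<lambda>i. grid_hexagon i j"] far grid_adjacent by blast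
  have column: "(grid_hexagon i j, grid_hexagon i j') \<in> hex_equiv K" if "N \<le> \<bar>i\<bar>" for i j j'
    using that hex_equiv_int_path[of "\<lambda>j. grid_hexagon i j"] far grid_adjacent by blast
  show ?thesis
    using mn
  proof
    assume "N \<le> \<bar>m\<bar>"
    then show ?thesis
      using hex_equiv_trans[OF column row] by simp
  next
    assume "N \<le> \<bar>n\<bar>"
    then show ?thesis
      using hex_equiv_trans[OF row column] by simp
  qed
qed

lemma hex_connected_hexagons: "hex_connected hexagons"
proof -
  have "(x, grid_hexagon 0 0) \<in> hex_equiv hexagons" if "x \<in> hexagons" for x
    \<comment> \<open>For \<open>N = 0\<close> the outside of the box is the whole grid.\<close>
    using that hex_equiv_outside_box[of 0 hexagons] by (force simp: hexagons_eq)
  then have "(x, y) \<in> hex_equiv hexagons" if "x \<in> hexagons" "y \<in> hexagons" for x y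
    using that by (blast intro: hex_equiv_sym hex_equiv_trans)
  then show ?thesis
    by (auto simp: hex_connected_iff hexagons_eq)
qed

lemma finite_hexagons_subset_box:
  assumes "finite K" "K \<subseteq> hexagons"
  obtains N where "\<And>m n. N \<le> \<bar>m\<bar> \<or> N \<le> \<bar>n\<bar> \<Longrightarrow> grid_hexagon m n \<notin> K"
proof -
  obtain S where S: "finite S" "K = (\<lambda>(m, n). grid_hexagon m n) ` S"
    using assms finite_subset_image unfolding hexagons_eq by metis
  \<comment> \<open>The inserted 0 keeps \<open>Max\<close> meaningful for empty \<open>S\<close>,
    and the added 1 makes the bounds strict.\<close>
  define N where "N = Max (insert 0 ((\<lambda>(m, n). max \<bar>m\<bar> \<bar>n\<bar>) ` S)) + 1"
  have "\<bar>m\<bar> < N \<and> \<bar>n\<bar> < N" if "(m, n) \<in> S" for m n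
  proof -
    have "max \<bar>m\<bar> \<bar>n\<bar> \<le> Max (insert 0 ((\<lambda>(m, n). max \<bar>m\<bar> \<bar>n\<bar>) ` S))"
      using S(1) that by (intro Max_ge) force+
    then show ?thesis
      unfolding N_def by simp
  qed
  then show ?thesis
    using that[of N] S(2) by fastforce
qed

section \<open>Decomposition of the complement of a coronoid\<close>

theorem theorem2p9:
  fixes K :: "complex set set"
  assumes "coronoid K"
  shows "\<exists>(d::nat) (Binf :: complex set set) (B :: nat \<Rightarrow> complex set set).
    hex_components (hexagons - K) = insert Binf (B ` {1..d}) \<and>
    card (hex_components (hexagons - K)) = d + 1 \<and>
    hexagons - K = Binf \<union> (\<Union>i\<in>{1..d}. B i) \<and>
    (\<forall>i\<in>{1..d}. Binf \<inter> B i = {}) \<and> disjoint_family_on B {1..d} \<and>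
    infinite Binf \<and>
    (\<forall>i\<in>{1..d}. finite (B i) \<and> benzenoid (B i)) \<and>
    benzenoid (hexagons - Binf)"
proof -
  let ?L = "hexagons - K"
  let ?P = "hex_components ?L"
  have K: "K \<subseteq> hexagons" "finite K" "hex_connected K"
    using assms by (auto simp: coronoid_def)
  obtain N where N: "\<And>m n. N \<le> \<bar>m\<bar> \<or> N \<le> \<bar>n\<bar> \<Longrightarrow> grid_hexagon m n \<notin> K"
    using finite_hexagons_subset_box[OF K(2,1)] by blast
  then have far: "grid_hexagon m n \<in> ?L" if "N \<le> \<bar>m\<bar> \<or> N \<le> \<bar>n\<bar>" for m n
    using that by (auto simp: hexagons_eq)
  \<comment> \<open>The class of the corner at which all walks outside the box end, so it contains
    everything outside.\<close>
  define Binf where "Binf = hex_equiv ?L `` {grid_hexagon N N}"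
  define box where "box = (\<lambda>(m, n). grid_hexagon m n) ` ({-N..N} \<times> {-N..N})"
  have box: "finite box"
    by (simp add: box_def)
  have Binf: "Binf \<in> ?P"
    unfolding Binf_def hex_components_def by (intro quotientI far) auto
  have far_Binf: "grid_hexagon m n \<in> Binf" if "N \<le> \<bar>m\<bar> \<or> N \<le> \<bar>n\<bar>" for m n
    unfolding Binf_def
    using hex_equiv_outside_box[of N ?L m n] far that by (auto intro: hex_equiv_sym)
  have compl_box: "hexagons - Binf \<subseteq> box"
  proof
    fix x assume "x \<in> hexagons - Binf"
    then obtain m n where x: "x = grid_hexagon m n" "x \<notin> Binf"
      by (auto simp: hexagons_eq)
    then have "\<bar>m\<bar> < N" "\<bar>n\<bar> < N"
      using far_Binf by (metis not_less)+
    then show "x \<in> box"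
      using x unfolding box_def by force
  qed
  \<comment> \<open>The whole grid line with first coordinate \<open>N\<close> lies in
    \<open>Binf\<close>.\<close>
  have inf: "infinite Binf"
  proof -
    have "inj_on (grid_hexagon N) UNIV"
      by (auto intro: injI)
    then have "infinite (range (grid_hexagon N))"
      using finite_imageD infinite_UNIV_int by blast
    moreover have "range (grid_hexagon N) \<subseteq> Binf"
      using far_Binf abs_ge_self by blast
    ultimately show ?thesis
      using finite_subset by blast
  qed
  have sub: "C \<subseteq> ?L" if "C \<in> ?P" for C
    using that Union_hex_components by (metis Union_upper)
  have disj: "C \<inter> C' = {}" if "C \<in> ?P" "C' \<in> ?P" "C \<noteq> C'" for C C'
    using that quotient_disj[OF equiv_hex_equiv] unfolding hex_components_def by blast
  have small: "C \<subseteq> box" if "C \<in> ?P - {Binf}" for C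
    using that sub disj[OF _ Binf] compl_box by blast
  \<comment> \<open>Applied to a finite component this is the complement condition for a benzenoid;
    applied to \<open>Binf\<close> it is the connectedness of
    \<open>hexagons - Binf\<close>.\<close>
  have connected_compl: "hex_connected (hexagons - C)" if "C \<in> ?P" for C
    using hex_connected_Diff_component[OF hex_connected_hexagons K(3,1) that] .
  \<comment> \<open>A finite box has finitely many subsets, which bounds the number of the other
    components.\<close>
  have "?P - {Binf} \<subseteq> Pow box"
    using small by blast
  then have fin: "finite (?P - {Binf})"
    using box finite_subset by blast
  define d where "d = card (?P - {Binf})"
  \<comment> \<open>A bijective enumeration starting at 1; its injectivity turns the disjointness of
    distinct classes into disjointness for distinct indices.\<close>
  obtain B where B: "bij_betw B {1..d} (?P - {Binf})"
    using ex_bij_betw_nat_finite_1[OF fin] unfolding d_def by blast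
  have img: "B ` {1..d} = ?P - {Binf}"
    using B by (rule bij_betw_imp_surj_on)
  have BP: "B i \<in> ?P - {Binf}" if "i \<in> {1..d}" for i
    using img that by blast
  have P: "?P = insert Binf (B ` {1..d})"
    using img Binf by blast
  have "card ?P = d + 1"
    using fin Binf card_Suc_Diff1[of ?P Binf] by (simp add: d_def)
  moreover have "?L = Binf \<union> (\<Union>i\<in>{1..d}. B i)"
    using Union_hex_components[of ?L] unfolding P by auto
  moreover have "Binf \<inter> B i = {}" if "i \<in> {1..d}" for i
    using BP[OF that] disj Binf by blast
  moreover have "disjoint_family_on B {1..d}"
    unfolding disjoint_family_on_def
  proof (intro ballI impI)
    fix i j assume "i \<in> {1..d}" "j \<in> {1..d}" "i \<noteq> j"
    then show "B i \<inter> B j = {}"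
      using BP disj B by (metis DiffD1 bij_betw_imp_inj_on inj_onD)
  qed
  moreover have "finite (B i) \<and> benzenoid (B i)" if "i \<in> {1..d}" for i
  proof -
    have "finite (B i)"
      using small[OF BP[OF that]] box finite_subset by blast
    then show ?thesis
      using BP[OF that] sub hex_connected_component connected_compl
      unfolding benzenoid_def coronoid_def by blast
  qed
  moreover have "benzenoid (hexagons - Binf)"
  proof -
    \<comment> \<open>The roles are exchanged here: the complement that must be connected is now the
      component \<open>Binf\<close> itself.\<close>
    have "hexagons - (hexagons - Binf) = Binf"
      using sub[OF Binf] by blast
    then show ?thesis
      using connected_compl[OF Binf] hex_connected_component[OF Binf] compl_box box finite_subset
      unfolding benzenoid_def coronoid_def by auto
  qed
  ultimately show ?thesis
    using P inf by blast
qed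

end
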